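(* Let $N=\{u_1,\dots,u_n\}$ be a finite ground set whose elements arrive in a stream in the order $u_1,\dots,u_n$, and let $f:2^N\to\mathbb{R}_{\ge 0}$ be a non-negative (not necessarily monotone) submodular function accessed through a value oracle. Consider a standardized $d$-knapsack constraint with capacity $b$ and costs $c_{i,j}$, let $\mathrm{OPT}=\max\{f(S): S\subseteq N \text{ feasible}\}$, and let $\epsilon>0$. Then the algorithm $\mathcal{B}_3$ described in the context (with the unconstrained subroutine being a deterministic $1/2$-approximation algorithm for unconstrained non-negative submodular maximization) satisfies: (i) it outputs a feasible set $S$ (i.e. $\sum_{u_j\in S}c_{i,j}\le b$ for all $1\le i\le d$) with $f(S)\ge (\frac{1}{4(d+1)}-\epsilon)\mathrm{OPT}$; (ii) it makes 1 pass over the data set, stores at most $O(\frac{b\log b}{\epsilon})$ elements, and has $O(\frac{\log b}{\epsilon})$ query complexity per element.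
   Context: Notation: $f(u\mid T)=f(T\cup\{u\})-f(T)$. Submodularity: $f(S)+f(T)\ge f(S\cup T)+f(S\cap T)$ for all $S,T\subseteq N$. Standardized $d$-knapsack: there is a common capacity $b>0$ and costs $c_{i,j}$ with $1\le c_{i,j}\le b$ for all $1\le i\le d$, $1\le j\le n$; a set $S\subseteq N$ is feasible iff $\sum_{u_j\in S} c_{i,j}\le b$ for every $1\le i\le d$. Unconstrained subroutine: $\mathrm{Unconstrained}(A)$ is a deterministic algorithm that, given $A\subseteq N$, returns a set $T\subseteq A$ with $f(T)\ge \frac12\max_{T'\subseteq A} f(T')$. Algorithm $\mathcal{B}_3$: for every $v\in\{(1+\epsilon)^k: k\in\mathbb{Z}\}$ (lazily) maintain sets $S_1^v,S_2^v,S^v$, initially empty; set $m=0$. For $j=1,\dots,n$, when $u_j$ arrives: update $m=\max\{m,\max_{1\le i\le d} f(\{u_j\})/c_{i,j}\}$; let $Q_j=\{(1+\epsilon)^k: k\in\mathbb{Z},\ m/(1+\epsilon)\le (1+\epsilon)^k\le 2(d+1)bm\}$; then for each $v\in Q_j$ with $\tau=\frac{v}{4(d+1)}$: if there is some $1\le i\le d$ with $c_{i,j}\ge b/2$ and $f(\{u_j\})/c_{i,j}\ge 2\tau/b$, set $S^v=\{u_j\}$; else if $f(u_j\mid S_1^v)/c_{i,j}\ge 2\tau/b$ and $\sum_{u_l\in S_1^v\cup\{u_j\}}c_{i,l}\le b$ for all $1\le i\le d$, add $u_j$ to $S_1^v$; else if the same conditions hold with $S_2^v$ in place of $S_1^v$,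 add $u_j$ to $S_2^v$. After the stream ends, for each $v\in Q_n$ set $S_3^v=\mathrm{Unconstrained}(S_1^v)$, and return the set $S$ of largest $f$-value among all $S_1^v,S_2^v,S_3^v,S^v$, $v\in Q_n$. *)

theory Defs
  imports Complex_Main
begin

section \<open>Value-oracle programs\<close>

text \<open>
  A deterministic program that can access the set function only by asking for its value
  at a set: it is a decision tree branching on the answers of the oracle.
\<close>

datatype ('a, 'r) prog =
    Return 'r
  | Query "'a set" "real \<Rightarrow> ('a, 'r) prog"

primrec bind_prog :: "('a, 'r) prog \<Rightarrow> ('r \<Rightarrow> ('a, 't) prog) \<Rightarrow> ('a, 't) prog" where
  "bind_prog (Return r) g = g r"
| "bind_prog (Query A k) g = Query A (\<lambda>x. bind_prog (k x) g)"

primrec map_prog :: "('x \<Rightarrow> ('a, 'r) prog) \<Rightarrow> 'x list \<Rightarrow> ('a, 'r list) prog" where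
  "map_prog g [] = Return []"
| "map_prog g (x # xs) =
     bind_prog (g x) (\<lambda>r. bind_prog (map_prog g xs) (\<lambda>rs. Return (r # rs)))"

primrec result :: "('a set \<Rightarrow> real) \<Rightarrow> ('a, 'r) prog \<Rightarrow> 'r" where
  "result f (Return r) = r"
| "result f (Query A k) = result f (k (f A))"

primrec queries :: "('a set \<Rightarrow> real) \<Rightarrow> ('a, 'r) prog \<Rightarrow> nat" where
  "queries f (Return r) = 0"
| "queries f (Query A k) = Suc (queries f (k (f A)))"

definition marginal :: "'a \<Rightarrow> 'a set \<Rightarrow> ('a, real) prog" where
  "marginal u T = Query (T \<union> {u}) (\<lambda>x. Query T (\<lambda>y. Return (x - y)))"

primrec argmax_from :: "'a set \<Rightarrow> real \<Rightarrow> 'a set list \<Rightarrow> ('a, 'a set) prog" where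
  "argmax_from A x [] = Return A"
| "argmax_from A x (B # Bs) =
     Query B (\<lambda>y. if y > x then argmax_from B y Bs else argmax_from A x Bs)"

text \<open>A member of the list with largest value; the empty set if there is no candidate.\<close>

fun argmax_prog :: "'a set list \<Rightarrow> ('a, 'a set) prog" where
  "argmax_prog [] = Return {}"
| "argmax_prog (A # As) = Query A (\<lambda>x. argmax_from A x As)"

section \<open>Streaming algorithms\<close>

text \<open>
  Between two arrivals nothing survives except the state. At the end of a pass
  \<open>pass_end\<close> is executed, and \<open>again\<close> decides whether the stream is
  read once more; otherwise \<open>final_output\<close> is returned.
\<close>

record ('a, 's) streaming_alg =
  initial :: 's
  arrive :: "'a \<Rightarrow> 's \<Rightarrow> ('a, 's) prog"
  pass_end :: "'s \<Rightarrow> ('a, 's) prog"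
  again :: "'s \<Rightarrow> bool"
  final_output :: "'s \<Rightarrow> ('a, 'a set) prog"

definition after_arrivals ::
  "('a, 's) streaming_alg \<Rightarrow> ('a set \<Rightarrow> real) \<Rightarrow> 'a list \<Rightarrow> 's \<Rightarrow> 's" where
  "after_arrivals A f us s = fold (\<lambda>u t. result f (arrive A u t)) us s"

definition after_pass ::
  "('a, 's) streaming_alg \<Rightarrow> ('a set \<Rightarrow> real) \<Rightarrow> 'a list \<Rightarrow> 's \<Rightarrow> 's" where
  "after_pass A f us s = result f (pass_end A (after_arrivals A f us s))"

text \<open>
  \<open>run A f us s p t\<close>: started in state \<open>s\<close>, the algorithm reads the stream
  \<open>us\<close> exactly \<open>p\<close> times and stops in state \<open>t\<close>.
\<close>

inductive run ::
  "('a, 's) streaming_alg \<Rightarrow> ('a set \<Rightarrow> real) \<Rightarrow> 'a list \<Rightarrow> 's \<Rightarrow> nat \<Rightarrow> 's \<Rightarrow> bool"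
  for A f us where
  stop: "\<not> again A (after_pass A f us s) \<Longrightarrow> run A f us s 1 (after_pass A f us s)"
| continue: "again A (after_pass A f us s) \<Longrightarrow> run A f us (after_pass A f us s) p t
    \<Longrightarrow> run A f us s (Suc p) t"

section \<open>Submodular maximization under a knapsack constraint\<close>

definition nonneg_submodular_on :: "'a set \<Rightarrow> ('a set \<Rightarrow> real) \<Rightarrow> bool" where
  "nonneg_submodular_on N f \<longleftrightarrow>
     (\<forall>S. S \<subseteq> N \<longrightarrow> f S \<ge> 0) \<and>
     (\<forall>S T. S \<subseteq> N \<and> T \<subseteq> N \<longrightarrow> f S + f T \<ge> f (S \<union> T) + f (S \<inter> T))"

definition standardized_knapsack :: "'a set \<Rightarrow> nat \<Rightarrow> real \<Rightarrow> (nat \<Rightarrow> 'a \<Rightarrow> real) \<Rightarrow> bool" where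
  "standardized_knapsack N d b c \<longleftrightarrow> b > 0 \<and> (\<forall>i\<in>{1..d}. \<forall>u\<in>N. 1 \<le> c i u \<and> c i u \<le> b)"

definition feasible :: "nat \<Rightarrow> real \<Rightarrow> (nat \<Rightarrow> 'a \<Rightarrow> real) \<Rightarrow> 'a set \<Rightarrow> bool" where
  "feasible d b c S \<longleftrightarrow> (\<forall>i\<in>{1..d}. (\<Sum>u\<in>S. c i u) \<le> b)"

definition OPT ::
  "'a set \<Rightarrow> ('a set \<Rightarrow> real) \<Rightarrow> nat \<Rightarrow> real \<Rightarrow> (nat \<Rightarrow> 'a \<Rightarrow> real) \<Rightarrow> real" where
  "OPT N f d b c = Max (f ` {S. S \<subseteq> N \<and> feasible d b c S})"

definition unconstrained_half_approx ::
  "'a set \<Rightarrow> ('a set \<Rightarrow> real) \<Rightarrow> ('a set \<Rightarrow> ('a, 'a set) prog) \<Rightarrow> bool" where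
  "unconstrained_half_approx N f unc \<longleftrightarrow>
     (\<forall>A. A \<subseteq> N \<longrightarrow>
        result f (unc A) \<subseteq> A \<and> f (result f (unc A)) \<ge> 1 / 2 * Max (f ` Pow A))"

section \<open>The algorithm\<close>

text \<open>The four sets kept for one guess \<open>v\<close>; \<open>single\<close> is \<open>S\<^sup>v\<close>.\<close>

record 'a bucket =
  S1 :: "'a set"
  S2 :: "'a set"
  S3 :: "'a set"
  single :: "'a set"

definition empty_bucket :: "'a bucket" where
  "empty_bucket = \<lparr>S1 = {}, S2 = {}, S3 = {}, single = {}\<rparr>"

record 'a b3_state =
  max_density :: real
  buckets :: "(real \<times> 'a bucket) list"

definition bucket_of :: "'a b3_state \<Rightarrow> real \<Rightarrow> 'a bucket" where
  "bucket_of s v = (case map_of (buckets s) v of None \<Rightarrow> empty_bucket | Some B \<Rightarrow> B)"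

definition stored :: "'a b3_state \<Rightarrow> nat" where
  "stored s =
     (\<Sum>(v, B)\<leftarrow>buckets s. card (S1 B) + card (S2 B) + card (S3 B) + card (single B))"

definition guesses :: "real \<Rightarrow> nat \<Rightarrow> real \<Rightarrow> real \<Rightarrow> real set" where
  "guesses \<epsilon> d b m =
     {v. \<exists>k::int. v = (1 + \<epsilon>) powi k \<and> m / (1 + \<epsilon>) \<le> v \<and> v \<le> 2 * (real d + 1) * b * m}"

definition addable ::
  "nat \<Rightarrow> real \<Rightarrow> (nat \<Rightarrow> 'a \<Rightarrow> real) \<Rightarrow> real \<Rightarrow> 'a \<Rightarrow> 'a set \<Rightarrow> real \<Rightarrow> bool" where
  "addable d b c \<tau> u T gain \<longleftrightarrow>
     (\<forall>i\<in>{1..d}. gain / c i u \<ge> 2 * \<tau> / b \<and> (\<Sum>l\<in>T \<union> {u}. c i l) \<le> b)"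

text \<open>Treatment of an arriving element \<open>u\<close> with \<open>fu = f {u}\<close> for the guess \<open>v\<close>.\<close>

definition b3_bucket_step ::
  "nat \<Rightarrow> real \<Rightarrow> (nat \<Rightarrow> 'a \<Rightarrow> real) \<Rightarrow> 'a \<Rightarrow> real \<Rightarrow> real \<Rightarrow> 'a bucket \<Rightarrow> ('a, 'a bucket) prog" where
  "b3_bucket_step d b c u fu v B =
     (let \<tau> = v / (4 * (real d + 1)) in
      if \<exists>i\<in>{1..d}. c i u \<ge> b / 2 \<and> fu / c i u \<ge> 2 * \<tau> / b
      then Return (B\<lparr>single := {u}\<rparr>)
      else bind_prog (marginal u (S1 B)) (\<lambda>g1.
        if addable d b c \<tau> u (S1 B) g1
        then Return (B\<lparr>S1 := S1 B \<union> {u}\<rparr>)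
        else bind_prog (marginal u (S2 B)) (\<lambda>g2.
          if addable d b c \<tau> u (S2 B) g2
          then Return (B\<lparr>S2 := S2 B \<union> {u}\<rparr>)
          else Return B)))"

text \<open>
  Buckets exist only for the current guesses. Since \<open>max_density\<close> never decreases, a guess
  that has dropped below the range never returns, so discarding its bucket loses nothing;
  a guess entering the range starts with empty sets.
\<close>

definition b3_arrive ::
  "real \<Rightarrow> nat \<Rightarrow> real \<Rightarrow> (nat \<Rightarrow> 'a \<Rightarrow> real) \<Rightarrow> 'a \<Rightarrow> 'a b3_state \<Rightarrow> ('a, 'a b3_state) prog" where
  "b3_arrive \<epsilon> d b c u s =
     Query {u} (\<lambda>fu.
       let m = max (max_density s) (Max ((\<lambda>i. fu / c i u) ` {1..d})) in
       bind_prog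
         (map_prog
           (\<lambda>v. bind_prog (b3_bucket_step d b c u fu v (bucket_of s v)) (\<lambda>B. Return (v, B)))
           (sorted_list_of_set (guesses \<epsilon> d b m)))
         (\<lambda>Bs. Return \<lparr>max_density = m, buckets = Bs\<rparr>))"

definition b3_pass_end ::
  "('a set \<Rightarrow> ('a, 'a set) prog) \<Rightarrow> 'a b3_state \<Rightarrow> ('a, 'a b3_state) prog" where
  "b3_pass_end unc s =
     bind_prog
       (map_prog (\<lambda>(v, B). bind_prog (unc (S1 B)) (\<lambda>T. Return (v, B\<lparr>S3 := T\<rparr>))) (buckets s))
       (\<lambda>Bs. Return (s\<lparr>buckets := Bs\<rparr>))"

definition b3_output :: "'a b3_state \<Rightarrow> ('a, 'a set) prog" where
  "b3_output s = argmax_prog (concat (map (\<lambda>(v, B). [S1 B, S2 B, S3 B, single B]) (buckets s)))"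

definition B3 ::
  "real \<Rightarrow> nat \<Rightarrow> real \<Rightarrow> (nat \<Rightarrow> 'a \<Rightarrow> real) \<Rightarrow> ('a set \<Rightarrow> ('a, 'a set) prog)
     \<Rightarrow> ('a, 'a b3_state) streaming_alg" where
  "B3 \<epsilon> d b c unc =
     \<lparr>initial = \<lparr>max_density = 0, buckets = []\<rparr>,
      arrive = b3_arrive \<epsilon> d b c,
      pass_end = b3_pass_end unc,
      again = (\<lambda>s. False),
      final_output = b3_output\<rparr>"

end

(*
  Fix a guess v with OPT / (1 + eps) < v <= OPT and put tau = v / (4 (d + 1)). If some element
  is stored as a singleton, it is worth at least tau; if an element of high density is rejected
  only for lack of space, the set that rejects it is more than half full at density 2 tau / b,
  hence is worth at least tau. Otherwise every element outside S1, and every element outside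
  S1 and S2, has a marginal value of at most 2 tau / b times one of its costs with respect to S1
  and S2, respectively. Summing over an optimal set O gives
    f (S1 Un O) <= f S1 + 2 tau d   and   f (S2 Un (O - S1)) <= f S2 + 2 tau d.
  The left-hand sides add up to at least f (O - S1), and f (O Int S1) <= 2 f S3, so that
  4 (d + 1) tau <= f O <= f S1 + f S2 + 2 f S3 + 4 tau d.
  Elements that arrive before v enters the range of guesses have density below 2 tau / b, so
  starting late with empty sets does no harm.
*)

theory Submission
  imports Defs
begin

section \<open>Value-oracle programs\<close>

lemma result_bind_prog [simp]: "result f (bind_prog p g) = result f (g (result f p))"
  by (induction p) auto

lemma queries_bind_prog [simp]:
  "queries f (bind_prog p g) = queries f p + queries f (g (result f p))"
  by (induction p) auto

lemma result_map_prog [simp]: "result f (map_prog g xs) = map (\<lambda>x. result f (g x)) xs"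
  by (induction xs) auto

lemma queries_map_prog [simp]: "queries f (map_prog g xs) = (\<Sum>x\<leftarrow>xs. queries f (g x))"
  by (induction xs) auto

lemma result_marginal [simp]: "result f (marginal u T) = f (T \<union> {u}) - f T"
  by (simp add: marginal_def)

lemma queries_marginal [simp]: "queries f (marginal u T) = 2"
  by (simp add: marginal_def)

lemma argmax_from_in: "result f (argmax_from A x Bs) \<in> set (A # Bs)"
  by (induction Bs arbitrary: A x) (fastforce split: if_splits)+

text \<open>\<open>x\<close> caches the value of the current best set \<open>A\<close>. Both change
  along the list, so the induction generalises over them.\<close>

lemma argmax_from_ge:
  assumes "x = f A" "B \<in> set (A # Bs)"
  shows "f B \<le> f (result f (argmax_from A x Bs))"
  using assms
proof (induction Bs arbitrary: A x B)
  case Nil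
  then show ?case by simp
next
  case (Cons B' Bs)
  show ?case
  proof (cases "f B' > x")
    case True
    have "f B' \<le> f (result f (argmax_from B' (f B') Bs))"
      by (rule Cons.IH) auto
    moreover have "B \<in> set Bs \<Longrightarrow> f B \<le> f (result f (argmax_from B' (f B') Bs))"
      by (rule Cons.IH) auto
    ultimately show ?thesis
      using True Cons.prems by auto
  next
    case False
    have "f A \<le> f (result f (argmax_from A x Bs))"
      by (rule Cons.IH) (use Cons.prems in auto)
    moreover have "B \<in> set Bs \<Longrightarrow> f B \<le> f (result f (argmax_from A x Bs))"
      by (rule Cons.IH) (use Cons.prems in auto)
    ultimately show ?thesis
      using False Cons.prems by auto
  qed
qed

lemma argmax_prog_in: "As \<noteq> [] \<Longrightarrow> result f (argmax_prog As) \<in> set As"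
  using argmax_from_in[of f] by (cases As) auto

lemma argmax_prog_ge: "A \<in> set As \<Longrightarrow> f A \<le> f (result f (argmax_prog As))"
  using argmax_from_ge[of _ f] by (cases As) auto

section \<open>Submodular functions\<close>

lemma submodular_onD:
  assumes "nonneg_submodular_on N f" "S \<subseteq> N" "T \<subseteq> N"
  shows "f (S \<union> T) + f (S \<inter> T) \<le> f S + f T"
  using assms by (auto simp: nonneg_submodular_on_def)

lemma nonneg_onD: "nonneg_submodular_on N f \<Longrightarrow> S \<subseteq> N \<Longrightarrow> 0 \<le> f S"
  by (auto simp: nonneg_submodular_on_def)

text \<open>Submodularity for \<open>T\<close> and \<open>S \<union> {u}\<close>: because
  \<open>u\<close> lies outside \<open>T\<close>, these two sets meet exactly in
  \<open>S\<close>.\<close>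

lemma marginal_antimono:
  assumes "nonneg_submodular_on N f" "S \<subseteq> T" "T \<subseteq> N" "u \<in> N" "u \<notin> T"
  shows "f (T \<union> {u}) - f T \<le> f (S \<union> {u}) - f S"
proof -
  have "T \<union> (S \<union> {u}) = T \<union> {u}" "T \<inter> (S \<union> {u}) = S"
    using assms by auto
  then show ?thesis
    using submodular_onD[OF assms(1), of T "S \<union> {u}"] assms(2-4) by (simp add: subset_trans)
qed

text \<open>Insert the elements of \<open>A\<close> one by one. By diminishing returns each gain is
  at most the gain of the same element over \<open>S\<close> alone.\<close>

lemma union_le_sum_marginals:
  assumes "nonneg_submodular_on N f" "S \<subseteq> N" "finite A" "A \<subseteq> N" "A \<inter> S = {}"
  shows "f (S \<union> A) \<le> f S + (\<Sum>u\<in>A. f (S \<union> {u}) - f S)"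
  using assms(3-5)
proof (induction A)
  case empty
  then show ?case by simp
next
  case (insert u A)
  have "f (S \<union> A \<union> {u}) - f (S \<union> A) \<le> f (S \<union> {u}) - f S"
    by (rule marginal_antimono[OF assms(1)]) (use insert assms(2) in auto)
  with insert show ?case by auto
qed

text \<open>\<open>f {}\<close> may be positive, and the sum of marginals leaves it with the
  coefficient \<open>1 - card A\<close>. This is nonpositive only for nonempty
  \<open>A\<close>.\<close>

lemma le_sum_singletons:
  assumes "nonneg_submodular_on N f" "finite A" "A \<subseteq> N" "A \<noteq> {}"
  shows "f A \<le> (\<Sum>u\<in>A. f {u})"
proof -
  have "f A \<le> f {} + (\<Sum>u\<in>A. f {u} - f {})"
    using union_le_sum_marginals[OF assms(1), of "{}" A] assms by simp
  also have "\<dots> = (\<Sum>u\<in>A. f {u}) + (1 - real (card A)) * f {}"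
    by (simp add: sum_subtractf algebra_simps)
  also have "\<dots> \<le> (\<Sum>u\<in>A. f {u})"
  proof -
    have "1 \<le> card A"
      using assms by (simp add: Suc_leI card_gt_0_iff)
    then show ?thesis
      using nonneg_onD[OF assms(1), of "{}"] by (simp add: mult_nonpos_nonneg)
  qed
  finally show ?thesis .
qed

section \<open>The range of guesses\<close>

text \<open>The hypothesis keeps the right-hand side nonnegative, which settles the case of an empty
  interval.\<close>

lemma card_int_interval_le:
  fixes x y :: real
  assumes "x \<le> y + 1"
  shows "real (card {\<lceil>x\<rceil>..\<lfloor>y\<rfloor>}) \<le> y - x + 1"
  using assms by (simp add: of_nat_nat; linarith)

text \<open>Taking logarithms to base \<open>1 + \<epsilon>\<close> turns the range of guesses into
  an interval of integer exponents.\<close>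

lemma guesses_subset:
  assumes "\<epsilon> > 0" "b > 0" "m > 0"
  shows "guesses \<epsilon> d b m \<subseteq>
    (\<lambda>k. (1 + \<epsilon>) powi k) ` {\<lceil>log (1 + \<epsilon>) (m / (1 + \<epsilon>))\<rceil>..\<lfloor>log (1 + \<epsilon>) (2 * (real d + 1) * b * m)\<rfloor>}"
proof
  fix v assume "v \<in> guesses \<epsilon> d b m"
  then obtain k :: int where k: "v = (1 + \<epsilon>) powi k" "m / (1 + \<epsilon>) \<le> v" "v \<le> 2 * (real d + 1) * b * m"
    by (auto simp: guesses_def)
  have v: "v = (1 + \<epsilon>) powr real_of_int k"
    using k(1) assms by (simp add: powr_real_of_int')
  have "log (1 + \<epsilon>) v = real_of_int k"
    using v assms by simp
  moreover have "v > 0" using v assms by simp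
  moreover have "log (1 + \<epsilon>) (m / (1 + \<epsilon>)) \<le> log (1 + \<epsilon>) v"
    using k(2) assms by (intro log_mono) auto
  moreover have "log (1 + \<epsilon>) v \<le> log (1 + \<epsilon>) (2 * (real d + 1) * b * m)"
    using k(3) assms \<open>v > 0\<close> by (intro log_mono) auto
  ultimately have "k \<in> {\<lceil>log (1 + \<epsilon>) (m / (1 + \<epsilon>))\<rceil>..\<lfloor>log (1 + \<epsilon>) (2 * (real d + 1) * b * m)\<rfloor>}"
    by (simp add: ceiling_le_iff le_floor_iff)
  then show "v \<in> (\<lambda>k. (1 + \<epsilon>) powi k) ` {\<lceil>log (1 + \<epsilon>) (m / (1 + \<epsilon>))\<rceil>..\<lfloor>log (1 + \<epsilon>) (2 * (real d + 1) * b * m)\<rfloor>}"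
    using k(1) by blast
qed

text \<open>Powers of \<open>1 + \<epsilon>\<close> are positive, while the upper end of the range
  is 0. Hence no bucket exists before an element of positive value arrives.\<close>

lemma guesses_zero: "\<epsilon> > 0 \<Longrightarrow> guesses \<epsilon> d b 0 = {}"
  by (auto simp: guesses_def not_le)

lemma finite_guesses:
  assumes "\<epsilon> > 0" "b > 0" "m \<ge> 0"
  shows "finite (guesses \<epsilon> d b m)"
proof (cases "m = 0")
  case True
  then show ?thesis using guesses_zero[OF assms(1)] by simp
next
  case False
  then show ?thesis
    using guesses_subset[of \<epsilon> b m d] assms by (auto intro: finite_subset)
qed

text \<open>Only the ratio of the two ends of the range matters, and \<open>m\<close> cancels in it.
  The bound is therefore the same at every moment of the stream.\<close>

lemma card_guesses_le:
  assumes "\<epsilon> > 0" "b \<ge> 1" "m \<ge> 0"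
  shows "real (card (guesses \<epsilon> d b m)) \<le> log (1 + \<epsilon>) (2 * (real d + 1) * (1 + \<epsilon>) * b) + 1"
proof -
  have "1 * 1 \<le> (2 * (real d + 1)) * b"
    using assms by (intro mult_mono) auto
  then have "1 * 1 \<le> (2 * (real d + 1) * b) * (1 + \<epsilon>)"
    using assms by (intro mult_mono) auto
  then have ge1: "1 \<le> 2 * (real d + 1) * (1 + \<epsilon>) * b"
    by (simp add: ac_simps)
  then have nonneg: "0 \<le> log (1 + \<epsilon>) (2 * (real d + 1) * (1 + \<epsilon>) * b)"
    using assms by (subst zero_le_log_cancel_iff) auto
  show ?thesis
  proof (cases "m = 0")
    case True
    then show ?thesis using guesses_zero[OF assms(1)] nonneg by simp
  next
    case False
    let ?x = "log (1 + \<epsilon>) (m / (1 + \<epsilon>))" and ?y = "log (1 + \<epsilon>) (2 * (real d + 1) * b * m)"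
    have "?y - ?x = log (1 + \<epsilon>) ((2 * (real d + 1) * b * m) / (m / (1 + \<epsilon>)))"
      using assms False by (intro log_divide_pos[symmetric]) auto
    also have "(2 * (real d + 1) * b * m) / (m / (1 + \<epsilon>)) = 2 * (real d + 1) * (1 + \<epsilon>) * b"
      using assms False by (simp add: field_simps)
    finally have eq: "?y - ?x = log (1 + \<epsilon>) (2 * (real d + 1) * (1 + \<epsilon>) * b)" .
    have "card (guesses \<epsilon> d b m) \<le> card ((\<lambda>k. (1 + \<epsilon>) powi k) ` {\<lceil>?x\<rceil>..\<lfloor>?y\<rfloor>})"
      using guesses_subset[of \<epsilon> b m d] assms False by (intro card_mono) auto
    also have "\<dots> \<le> card {\<lceil>?x\<rceil>..\<lfloor>?y\<rfloor>}"
      by (intro card_image_le) auto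
    finally show ?thesis
      using card_int_interval_le[of ?x ?y] eq nonneg by linarith
  qed
qed

text \<open>This carries the asymptotic claim: \<open>K\<close> depends on \<open>d\<close>,
  \<open>b0\<close> and \<open>\<epsilon>0\<close> only. Constant terms are absorbed because
  \<open>ln b\<close> is at least \<open>ln b0 > 0\<close>.\<close>

lemma card_guesses_bound:
  fixes d :: nat and b0 \<epsilon>0 :: real
  assumes "b0 > 1" "\<epsilon>0 > 0"
  shows "\<exists>K>0. \<forall>b \<epsilon> m. b \<ge> b0 \<and> 0 < \<epsilon> \<and> \<epsilon> \<le> \<epsilon>0 \<and> m \<ge> 0 \<longrightarrow>
    1 \<le> K * (ln b / \<epsilon>) \<and> real (card (guesses \<epsilon> d b m)) \<le> K * (ln b / \<epsilon>)"
proof -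
  define L where "L = ln (2 * (real d + 1) * (1 + \<epsilon>0))"
  \<comment> \<open>The first summand pays for the logarithm, the second for the additive 1 in
    \<open>card_guesses_le\<close>.\<close>
  define K where "K = (1 + \<epsilon>0) * (L / ln b0 + 1) + \<epsilon>0 / ln b0"
  have lnb0: "ln b0 > 0" using assms by simp
  have "1 * 1 \<le> (2 * (real d + 1)) * (1 + \<epsilon>0)"
    using assms by (intro mult_mono) auto
  then have L: "L \<ge> 0" by (simp add: L_def)
  have "1 \<le> K * (ln b / \<epsilon>) \<and> real (card (guesses \<epsilon> d b m)) \<le> K * (ln b / \<epsilon>)"
    if h: "b \<ge> b0" "0 < \<epsilon>" "\<epsilon> \<le> \<epsilon>0" "m \<ge> 0" for b \<epsilon> m
  proof -
    have lnb: "ln b0 \<le> ln b" using h assms by simp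
    have one: "1 \<le> \<epsilon>0 / ln b0 * (ln b / \<epsilon>)"
    proof -
      have "1 * 1 \<le> (\<epsilon>0 / \<epsilon>) * (ln b / ln b0)"
        using h lnb lnb0 by (intro mult_mono) auto
      then show ?thesis by (simp add: field_simps)
    qed
    have "L \<le> L / ln b0 * ln b"
      using mult_left_mono[OF lnb L] lnb0 by (simp add: field_simps)
    moreover have "ln (2 * (real d + 1) * (1 + \<epsilon>) * b) = ln (2 * (real d + 1) * (1 + \<epsilon>)) + ln b"
      using h assms by (intro ln_mult_pos) auto
    moreover have "ln (2 * (real d + 1) * (1 + \<epsilon>)) \<le> L"
      unfolding L_def using h assms by (subst ln_le_cancel_iff) auto
    ultimately have num: "ln (2 * (real d + 1) * (1 + \<epsilon>) * b) \<le> (L / ln b0 + 1) * ln b"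
      by (simp add: algebra_simps)
    \<comment> \<open>The denominator \<open>1 + \<epsilon>\<close> is enlarged to
      \<open>1 + \<epsilon>0\<close> so that the constant does not depend on
      \<open>\<epsilon>\<close>.\<close>
    have den: "\<epsilon> / (1 + \<epsilon>0) \<le> ln (1 + \<epsilon>)"
    proof -
      have "\<epsilon> / (1 + \<epsilon>0) \<le> \<epsilon> / (1 + \<epsilon>)"
        using h by (intro divide_left_mono) auto
      also have "\<dots> \<le> ln (1 + \<epsilon>)"
        using ln_diff_le[of 1 "1 + \<epsilon>"] h by (simp add: field_simps)
      finally show ?thesis .
    qed
    have "0 \<le> (L / ln b0 + 1) * ln b"
      using L lnb lnb0 by simp
    then have "log (1 + \<epsilon>) (2 * (real d + 1) * (1 + \<epsilon>) * b) \<le> ((L / ln b0 + 1) * ln b) / (\<epsilon> / (1 + \<epsilon>0))"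
      unfolding log_def using num den h by (intro frac_le) auto
    also have "\<dots> = (1 + \<epsilon>0) * (L / ln b0 + 1) * (ln b / \<epsilon>)"
      by (simp add: field_simps)
    finally have "log (1 + \<epsilon>) (2 * (real d + 1) * (1 + \<epsilon>) * b) + 1 \<le> K * (ln b / \<epsilon>)"
      using one by (simp add: K_def algebra_simps)
    moreover have "1 \<le> K * (ln b / \<epsilon>)"
    proof -
      have "0 \<le> (1 + \<epsilon>0) * (L / ln b0 + 1) * (ln b / \<epsilon>)"
        using L lnb lnb0 h assms by simp
      then show ?thesis using one by (simp add: K_def algebra_simps)
    qed
    ultimately show ?thesis
      using card_guesses_le[of \<epsilon> b m d] h assms by linarith
  qed
  moreover have "K > 0"
    using assms L lnb0 by (simp add: K_def add_nonneg_pos)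
  ultimately show ?thesis by blast
qed

text \<open>The exponent is the floor of the logarithm of \<open>x\<close>: the largest power not
  above \<open>x\<close> misses it by a factor below \<open>1 + \<epsilon>\<close>.\<close>

lemma ex_guess_near:
  fixes \<epsilon> x :: real
  assumes "\<epsilon> > 0" "x > 0"
  obtains k :: int where "(1 + \<epsilon>) powi k \<le> x" "x / (1 + \<epsilon>) < (1 + \<epsilon>) powi k"
proof
  let ?k = "\<lfloor>log (1 + \<epsilon>) x\<rfloor>"
  have e: "(1 + \<epsilon>) powi ?k = (1 + \<epsilon>) powr real_of_int ?k"
    using assms by (simp add: powr_real_of_int')
  have x: "x = (1 + \<epsilon>) powr log (1 + \<epsilon>) x"
    using assms by simp
  show "(1 + \<epsilon>) powi ?k \<le> x"
    unfolding e by (subst (2) x) (use assms in \<open>intro powr_mono; simp\<close>)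
  have "x < (1 + \<epsilon>) powr (real_of_int ?k + 1)"
    by (subst x) (use assms in \<open>intro powr_less_mono; simp\<close>)
  also have "\<dots> = (1 + \<epsilon>) powr real_of_int ?k * (1 + \<epsilon>)"
    using assms by (simp add: powr_add)
  finally show "x / (1 + \<epsilon>) < (1 + \<epsilon>) powi ?k"
    unfolding e using assms by (simp add: field_simps)
qed

section \<open>Invariants of the algorithm\<close>

locale b3_setting =
  fixes N :: "'a set" and f :: "'a set \<Rightarrow> real" and d :: nat and b :: real
    and c :: "nat \<Rightarrow> 'a \<Rightarrow> real" and \<epsilon> :: real
  assumes fin: "finite N" and d: "d \<ge> 1" and submod: "nonneg_submodular_on N f"
    and knap: "standardized_knapsack N d b c" and eps: "\<epsilon> > 0"
begin

section \<open>Costs, marginals and feasible sets\<close>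

lemma b_pos: "b > 0"
  using knap by (simp add: standardized_knapsack_def)

lemma cost_ge: "i \<in> {1..d} \<Longrightarrow> u \<in> N \<Longrightarrow> 1 \<le> c i u"
  and cost_le: "i \<in> {1..d} \<Longrightarrow> u \<in> N \<Longrightarrow> c i u \<le> b"
  using knap by (auto simp: standardized_knapsack_def)

lemma nonneg: "S \<subseteq> N \<Longrightarrow> 0 \<le> f S"
  using submod by (rule nonneg_onD)

lemma marginal_le_singleton:
  assumes "S \<subseteq> N" "u \<in> N" "u \<notin> S"
  shows "f (S \<union> {u}) - f S \<le> f {u}"
  using marginal_antimono[OF submod, of "{}" S u] assms nonneg[of "{}"] by simp

text \<open>Every cost is at least 1, so the first dimension alone bounds the number of elements.
  This is the source of the factor \<open>b\<close> in the space bound.\<close>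

lemma feasible_card_le:
  assumes "S \<subseteq> N" "feasible d b c S"
  shows "real (card S) \<le> b"
proof -
  have "real (card S) = (\<Sum>u\<in>S. 1)" by simp
  also have "\<dots> \<le> (\<Sum>u\<in>S. c 1 u)"
    using assms d by (intro sum_mono cost_ge) auto
  also have "\<dots> \<le> b"
    using assms d by (auto simp: feasible_def)
  finally show ?thesis .
qed

lemma feasible_subset:
  assumes "S \<subseteq> N" "feasible d b c S" "T \<subseteq> S"
  shows "feasible d b c T"
  unfolding feasible_def
proof
  fix i assume i: "i \<in> {1..d}"
  have "0 \<le> c i u" if "u \<in> S" for u
    using cost_ge[OF i, of u] that assms by force
  then have "(\<Sum>u\<in>T. c i u) \<le> (\<Sum>u\<in>S. c i u)"
    using assms fin by (intro sum_mono2) (auto intro: finite_subset)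
  then show "(\<Sum>u\<in>T. c i u) \<le> b"
    using assms i by (force simp: feasible_def)
qed

lemma feasible_empty: "feasible d b c {}"
  using b_pos by (simp add: feasible_def)

lemma feasible_singleton: "u \<in> N \<Longrightarrow> feasible d b c {u}"
  using cost_le by (simp add: feasible_def)

section \<open>The invariant of a single bucket\<close>

text \<open>\<open>target v\<close> is \<open>\<tau>\<close> and \<open>threshold v\<close> is \<open>2\<tau>/b\<close>.\<close>

definition target :: "real \<Rightarrow> real" where
  "target v = v / (4 * (real d + 1))"

lemma guess_eq_target: "v = 4 * (real d + 1) * target v"
proof -
  have "4 * (real d + 1) > 0" by simp
  then have "4 * (real d + 1) \<noteq> 0" by linarith
  then show ?thesis
    unfolding target_def times_divide_eq_right by (rule nonzero_mult_div_cancel_left[symmetric])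
qed

definition threshold :: "real \<Rightarrow> real" where
  "threshold v = 2 * target v / b"

text \<open>Every accepted element has density at least \<open>threshold v\<close> in all
  dimensions, so the value grows linearly with each used capacity. The term \<open>f {}\<close>
  accounts for \<open>f\<close> not being normalised.\<close>

definition grown :: "real \<Rightarrow> 'a set \<Rightarrow> bool" where
  "grown v S \<longleftrightarrow> S \<subseteq> N \<and> feasible d b c S \<and>
     (\<forall>i\<in>{1..d}. f {} + threshold v * (\<Sum>u\<in>S. c i u) \<le> f S)"

text \<open>One dimension suffices because acceptance demands the density in all of them.\<close>

definition low :: "real \<Rightarrow> 'a set \<Rightarrow> 'a \<Rightarrow> bool" where
  "low v S u \<longleftrightarrow> (\<exists>i\<in>{1..d}. f (S \<union> {u}) - f S \<le> threshold v * c i u)"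

text \<open>Either a stored set is already good enough, or nothing left outside is dense. The second
  condition skips \<open>P\<close> because an element accepted by the first set is never offered to
  the second.\<close>

definition progress :: "'a set \<Rightarrow> real \<Rightarrow> 'a set \<Rightarrow> 'a set \<Rightarrow> 'a set \<Rightarrow> bool" where
  "progress X v P Q R \<longleftrightarrow> R \<noteq> {} \<or> target v \<le> f P \<or> target v \<le> f Q \<or>
     (\<forall>u\<in>X - P. low v P u) \<and> (\<forall>u\<in>X - P - Q. low v Q u)"

text \<open>\<open>S3\<close> is still empty because it is filled only at the end of the pass.
  Disjointness of \<open>S1\<close> and \<open>S2\<close> is what the final submodularity argument
  needs.\<close>

definition bucket_inv :: "'a set \<Rightarrow> real \<Rightarrow> 'a bucket \<Rightarrow> bool" where
  "bucket_inv X v B \<longleftrightarrow>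
     S1 B \<subseteq> X \<and> S2 B \<subseteq> X \<and> S1 B \<inter> S2 B = {} \<and> S3 B = {} \<and>
     grown v (S1 B) \<and> grown v (S2 B) \<and>
     (single B = {} \<or> (\<exists>u\<in>X. single B = {u} \<and> target v \<le> f {u})) \<and>
     progress X v (S1 B) (S2 B) (single B)"

lemma threshold_pos: "v > 0 \<Longrightarrow> threshold v > 0"
  using b_pos by (simp add: threshold_def target_def)

lemma grown_empty: "grown v {}"
  using feasible_empty by (simp add: grown_def)

lemma grown_ge_empty:
  assumes "v > 0" "grown v S"
  shows "f {} \<le> f S"
proof -
  have "0 \<le> c 1 u" if "u \<in> S" for u
    using cost_ge[of 1 u] that assms d by (force simp: grown_def)
  then have "0 \<le> (\<Sum>u\<in>S. c 1 u)"
    by (rule sum_nonneg)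
  then have "0 \<le> threshold v * (\<Sum>u\<in>S. c 1 u)"
    using threshold_pos[OF assms(1)] by simp
  moreover have "f {} + threshold v * (\<Sum>u\<in>S. c 1 u) \<le> f S"
    using assms d by (auto simp: grown_def)
  ultimately show ?thesis by linarith
qed

lemma density_ge_iff:
  assumes "i \<in> {1..d}" "u \<in> N"
  shows "2 * target v / b \<le> x / c i u \<longleftrightarrow> threshold v * c i u \<le> x"
  using cost_ge[OF assms] by (simp add: threshold_def pos_le_divide_eq)

lemma addable_marginal:
  assumes "addable d b c (target v) u S x" "u \<in> N" "i \<in> {1..d}"
  shows "threshold v * c i u \<le> x"
  using assms(1) density_ge_iff[OF assms(3,2), of v x] assms(3) unfolding addable_def by blast

lemma grown_add:
  assumes "grown v S" "u \<in> N" "u \<notin> S" "addable d b c (target v) u S (f (S \<union> {u}) - f S)"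
  shows "grown v (S \<union> {u})"
  unfolding grown_def
proof (intro conjI ballI)
  show "S \<union> {u} \<subseteq> N"
    using assms by (auto simp: grown_def)
  show "feasible d b c (S \<union> {u})"
    using assms by (auto simp: addable_def feasible_def)
  fix i assume i: "i \<in> {1..d}"
  have "finite S"
    using assms fin by (auto simp: grown_def intro: finite_subset)
  then have "(\<Sum>l\<in>S \<union> {u}. c i l) = (\<Sum>l\<in>S. c i l) + c i u"
    using assms(3) by simp
  moreover have "threshold v * c i u \<le> f (S \<union> {u}) - f S"
    by (rule addable_marginal[OF assms(4,2) i])
  moreover have "f {} + threshold v * (\<Sum>l\<in>S. c i l) \<le> f S"
    using assms(1) i by (simp add: grown_def)
  ultimately show "f {} + threshold v * (\<Sum>l\<in>S \<union> {u}. c i l) \<le> f (S \<union> {u})"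
    by (simp add: algebra_simps)
qed

text \<open>Although \<open>f\<close> need not be monotone, accepted elements have nonnegative gain.
  Hence a set that has reached \<open>target v\<close> never falls below it again.\<close>

lemma addable_increases:
  assumes "v > 0" "u \<in> N" "addable d b c (target v) u S (f (S \<union> {u}) - f S)"
  shows "f S \<le> f (S \<union> {u})"
proof -
  have "threshold v * c 1 u \<le> f (S \<union> {u}) - f S"
    by (rule addable_marginal[OF assms(3,2)]) (use d in simp)
  moreover have "0 \<le> threshold v * c 1 u"
    using threshold_pos[OF assms(1)] cost_ge[of 1 u] assms d by simp
  ultimately show ?thesis by linarith
qed

lemma low_mono:
  assumes "low v S u" "S \<subseteq> T" "T \<subseteq> N" "u \<in> N" "u \<notin> T"
  shows "low v T u"
  using assms marginal_antimono[OF submod, of S T u] unfolding low_def by (meson order_trans)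

text \<open>If \<open>u\<close> is not low, it passes the density test everywhere, so some dimension
  \<open>i\<close> overflows. Since \<open>u\<close> costs less than \<open>b / 2\<close> there,
  \<open>S\<close> already uses at least \<open>b / 2\<close>, and \<open>grown\<close> turns this
  into \<open>threshold v * (b / 2) = target v\<close>.\<close>

lemma rejected:
  assumes "v > 0" "grown v S" "u \<in> N" "u \<notin> S"
    and reject: "\<not> addable d b c (target v) u S (f (S \<union> {u}) - f S)"
    and small: "\<not> (\<exists>i\<in>{1..d}. c i u \<ge> b / 2 \<and> f {u} / c i u \<ge> 2 * target v / b)"
  shows "target v \<le> f S \<or> low v S u"
proof (cases "low v S u")
  case False
  have dense: "threshold v * c i u < f (S \<union> {u}) - f S" if "i \<in> {1..d}" for i
    using False that unfolding low_def by (meson not_le)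
  then obtain i where i: "i \<in> {1..d}" "(\<Sum>l\<in>S \<union> {u}. c i l) > b"
    using reject density_ge_iff[OF _ assms(3)] unfolding addable_def by (meson less_imp_le not_le)
  have "finite S" "S \<subseteq> N"
    using assms fin by (auto simp: grown_def intro: finite_subset)
  \<comment> \<open>\<open>small\<close> tests the singleton value while \<open>dense\<close>
    concerns the marginal; diminishing returns lead from the latter to the former.\<close>
  have "threshold v * c i u \<le> f {u}"
    using dense[OF i(1)] marginal_le_singleton[of S u] \<open>S \<subseteq> N\<close> assms by simp
  then have "c i u < b / 2"
    using small i density_ge_iff[OF i(1) assms(3)] by force
  then have "b / 2 \<le> (\<Sum>l\<in>S. c i l)"
    using i(2) \<open>finite S\<close> assms(4) by simp
  then have "threshold v * (b / 2) \<le> threshold v * (\<Sum>l\<in>S. c i l)"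
    using threshold_pos[OF assms(1)] by (intro mult_left_mono) auto
  also have "\<dots> \<le> f S"
  proof -
    have "f {} + threshold v * (\<Sum>u\<in>S. c i u) \<le> f S"
      using assms(2) i by (simp add: grown_def)
    then show ?thesis using nonneg[of "{}"] by simp
  qed
  finally have "threshold v * (b / 2) \<le> f S" .
  then show ?thesis
    using b_pos by (simp add: threshold_def)
qed simp

text \<open>Elements of small density are low for the empty set. This justifies opening a bucket
  late, as if all earlier elements had been offered to it and rejected.\<close>

lemma bucket_inv_empty:
  assumes "X \<subseteq> N" "\<And>u i. u \<in> X \<Longrightarrow> i \<in> {1..d} \<Longrightarrow> f {u} \<le> threshold v * c i u"
  shows "bucket_inv X v empty_bucket"
proof -
  have "low v {} u" if "u \<in> X" for u
    using assms(2)[OF that, of 1] d nonneg[of "{}"] by (force simp: low_def)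
  then show ?thesis
    by (simp add: bucket_inv_def empty_bucket_def grown_empty progress_def)
qed

lemma result_b3_bucket_step:
  "result f (b3_bucket_step d b c u x v B) =
    (if \<exists>i\<in>{1..d}. c i u \<ge> b / 2 \<and> x / c i u \<ge> 2 * target v / b then B\<lparr>single := {u}\<rparr>
     else if addable d b c (target v) u (S1 B) (f (S1 B \<union> {u}) - f (S1 B))
       then B\<lparr>S1 := S1 B \<union> {u}\<rparr>
     else if addable d b c (target v) u (S2 B) (f (S2 B \<union> {u}) - f (S2 B))
       then B\<lparr>S2 := S2 B \<union> {u}\<rparr>
     else B)"
  unfolding b3_bucket_step_def Let_def target_def[symmetric]
  by (simp add: if_distrib[of "result f"] cong: if_cong split del: if_split)

lemma bucket_inv_step:
  assumes v: "v > 0" and inv: "bucket_inv X v B" and X: "X \<subseteq> N" "u \<in> N" "u \<notin> X"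
  shows "bucket_inv (insert u X) v (result f (b3_bucket_step d b c u (f {u}) v B))"
proof (cases "\<exists>i\<in>{1..d}. c i u \<ge> b / 2 \<and> f {u} / c i u \<ge> 2 * target v / b")
  case True
  then obtain i where i: "i \<in> {1..d}" "c i u \<ge> b / 2" "threshold v * c i u \<le> f {u}"
    using density_ge_iff[OF _ X(2)] by blast
  \<comment> \<open>A singleton is stored only if it costs at least half the capacity at the
    required density, which is worth \<open>target v\<close>.\<close>
  have "target v = threshold v * (b / 2)"
    using b_pos by (simp add: threshold_def)
  also have "\<dots> \<le> threshold v * c i u"
    using i threshold_pos[OF v] by (intro mult_left_mono) auto
  finally have "target v \<le> f {u}"
    using i by linarith
  moreover have "result f (b3_bucket_step d b c u (f {u}) v B) = B\<lparr>single := {u}\<rparr>"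
    using True unfolding result_b3_bucket_step by (rule if_P)
  ultimately show ?thesis
    using inv by (auto simp: bucket_inv_def progress_def)
next
  case small: False
  note parts = inv[unfolded bucket_inv_def]
  have notin: "u \<notin> S1 B" "u \<notin> S2 B"
    using parts X by auto
  let ?add = "\<lambda>S. addable d b c (target v) u S (f (S \<union> {u}) - f S)"
  have step: "result f (b3_bucket_step d b c u (f {u}) v B) =
    (if ?add (S1 B) then B\<lparr>S1 := S1 B \<union> {u}\<rparr>
     else if ?add (S2 B) then B\<lparr>S2 := S2 B \<union> {u}\<rparr> else B)"
    using small unfolding result_b3_bucket_step by (rule if_not_P)
  \<comment> \<open>Used with \<open>D = {}\<close> for the first set and with
    \<open>D = S1 B\<close> for the second. The newcomer belongs to the enlarged set, so only older
    elements have to stay low.\<close>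
  have low': "\<forall>w\<in>insert u X - D - (S \<union> {u}). low v (S \<union> {u}) w"
    if "\<forall>w\<in>X - D - S. low v S w" "S \<subseteq> X" for S D
  proof
    fix w assume w: "w \<in> insert u X - D - (S \<union> {u})"
    then have "low v S w" using that by blast
    then show "low v (S \<union> {u}) w"
      by (rule low_mono) (use that w X in auto)
  qed
  show ?thesis
  proof (cases "?add (S1 B)")
    case True
    have "grown v (S1 B \<union> {u})"
      by (rule grown_add) (use parts notin X True in auto)
    moreover have "progress (insert u X) v (S1 B \<union> {u}) (S2 B) (single B)"
    proof (cases "single B \<noteq> {} \<or> target v \<le> f (S1 B) \<or> target v \<le> f (S2 B)")
      case big: True
      have "f (S1 B) \<le> f (S1 B \<union> {u})"
        by (rule addable_increases[OF v X(2) True])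
      then show ?thesis using big by (auto simp: progress_def)
    next
      case False
      then have "\<forall>w\<in>X - S1 B. low v (S1 B) w" "\<forall>w\<in>X - S1 B - S2 B. low v (S2 B) w"
        using parts by (auto simp: progress_def)
      moreover from this(1) have "\<forall>w\<in>insert u X - {} - (S1 B \<union> {u}). low v (S1 B \<union> {u}) w"
        using parts by (intro low') auto
      \<comment> \<open>Once \<open>u\<close> is in the first set, the condition on the second set
        does not concern it.\<close>
      ultimately show ?thesis
        unfolding progress_def by blast
    qed
    moreover have "result f (b3_bucket_step d b c u (f {u}) v B) = B\<lparr>S1 := S1 B \<union> {u}\<rparr>"
      using True unfolding step by (rule if_P)
    ultimately show ?thesis
      using parts notin by (auto simp: bucket_inv_def)
  next
    case rej1: False
    have r1: "target v \<le> f (S1 B) \<or> low v (S1 B) u"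
      by (rule rejected) (use parts notin X v rej1 small in auto)
    show ?thesis
    proof (cases "?add (S2 B)")
      case True
      have "grown v (S2 B \<union> {u})"
        by (rule grown_add) (use parts notin X True in auto)
      moreover have "progress (insert u X) v (S1 B) (S2 B \<union> {u}) (single B)"
      proof (cases "single B \<noteq> {} \<or> target v \<le> f (S1 B) \<or> target v \<le> f (S2 B)")
        case big: True
        have "f (S2 B) \<le> f (S2 B \<union> {u})"
          by (rule addable_increases[OF v X(2) True])
        then show ?thesis using big by (auto simp: progress_def)
      next
        case False
        then have "\<forall>w\<in>insert u X - S1 B. low v (S1 B) w" "\<forall>w\<in>X - S1 B - S2 B. low v (S2 B) w"
          using parts r1 by (auto simp: progress_def)
        moreover from this(2) have "\<forall>w\<in>insert u X - S1 B - (S2 B \<union> {u}). low v (S2 B \<union> {u}) w"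
          using parts by (intro low') auto
        ultimately show ?thesis
          unfolding progress_def by blast
      qed
      moreover have "result f (b3_bucket_step d b c u (f {u}) v B) = B\<lparr>S2 := S2 B \<union> {u}\<rparr>"
        unfolding step using rej1 True by (simp only: if_False if_True)
      ultimately show ?thesis
        using parts notin by (auto simp: bucket_inv_def)
    next
      case rej2: False
      have r2: "target v \<le> f (S2 B) \<or> low v (S2 B) u"
        by (rule rejected) (use parts notin X v rej2 small in auto)
      have "progress (insert u X) v (S1 B) (S2 B) (single B)"
        using parts r1 r2 by (auto simp: progress_def)
      moreover have "result f (b3_bucket_step d b c u (f {u}) v B) = B"
        unfolding step using rej1 rej2 by (simp only: if_False)
      ultimately show ?thesis
        using parts by (auto simp: bucket_inv_def)
    qed
  qed
qed

section \<open>The invariant of the whole state\<close>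

text \<open>
  The last conjunct ranges over all guesses above the lower end of the current range, also over
  those that have not entered it yet.
\<close>

definition state_inv :: "'a set \<Rightarrow> 'a b3_state \<Rightarrow> bool" where
  "state_inv X s \<longleftrightarrow>
     0 \<le> max_density s \<and>
     (\<forall>u\<in>X. \<forall>i\<in>{1..d}. f {u} \<le> max_density s * c i u) \<and>
     (max_density s = 0 \<or> (\<exists>u\<in>X. max_density s \<le> f {u})) \<and>
     map fst (buckets s) = sorted_list_of_set (guesses \<epsilon> d b (max_density s)) \<and>
     (\<forall>k::int. max_density s / (1 + \<epsilon>) \<le> (1 + \<epsilon>) powi k \<longrightarrow>
        bucket_inv X ((1 + \<epsilon>) powi k) (bucket_of s ((1 + \<epsilon>) powi k)))"

lemma state_inv_initial: "state_inv {} \<lparr>max_density = 0, buckets = []\<rparr>"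
  using guesses_zero[OF eps] bucket_inv_empty[of "{}"]
  by (simp add: state_inv_def bucket_of_def)

lemma result_b3_arrive:
  "result f (b3_arrive \<epsilon> d b c u s) =
    (let m = max (max_density s) (Max ((\<lambda>i. f {u} / c i u) ` {1..d})) in
     \<lparr>max_density = m,
      buckets = map (\<lambda>v. (v, result f (b3_bucket_step d b c u (f {u}) v (bucket_of s v))))
        (sorted_list_of_set (guesses \<epsilon> d b m))\<rparr>)"
  by (simp add: b3_arrive_def Let_def)

text \<open>A guess inside the new range is updated by one bucket step. A guess above it still has
  the empty bucket, which is harmless because all densities seen so far are at most
  \<open>m\<close>, hence at most its threshold.\<close>

lemma state_inv_arrive:
  assumes inv: "state_inv X s" and X: "X \<subseteq> N" "u \<in> N" "u \<notin> X"
  shows "state_inv (insert u X) (result f (b3_arrive \<epsilon> d b c u s))"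
proof -
  define D where "D = (\<lambda>i. f {u} / c i u) ` {1..d}"
  define m where "m = max (max_density s) (Max D)"
  define s' where "s' = result f (b3_arrive \<epsilon> d b c u s)"
  let ?step = "\<lambda>v. result f (b3_bucket_step d b c u (f {u}) v (bucket_of s v))"
  have s': "s' = \<lparr>max_density = m, buckets = map (\<lambda>v. (v, ?step v)) (sorted_list_of_set (guesses \<epsilon> d b m))\<rparr>"
    by (simp add: s'_def result_b3_arrive m_def D_def Let_def)
  have m: "max_density s \<le> m" "0 \<le> m"
    using inv by (auto simp: m_def state_inv_def)
  have D: "finite D" "D \<noteq> {}"
    using d by (auto simp: D_def)
  have fin_guesses: "finite (guesses \<epsilon> d b m)"
    using finite_guesses[OF eps b_pos m(2)] .
  have bound: "f {w} \<le> m * c i w" if "w \<in> insert u X" "i \<in> {1..d}" for w i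
  proof (cases "w = u")
    case True
    have "f {u} / c i u \<le> Max D"
      using D(1) that by (intro Max_ge) (auto simp: D_def)
    then have "f {u} / c i u \<le> m" by (simp add: m_def)
    then show ?thesis
      using cost_ge[OF that(2) X(2)] True by (simp add: pos_divide_le_eq)
  next
    case False
    then have "w \<in> X" using that by simp
    then have "f {w} \<le> max_density s * c i w"
      using inv that by (simp add: state_inv_def)
    also have "\<dots> \<le> m * c i w"
      using m(1) cost_ge[OF that(2), of w] \<open>w \<in> X\<close> X by (intro mult_right_mono) force+
    finally show ?thesis .
  qed
  have witness: "m = 0 \<or> (\<exists>w\<in>insert u X. m \<le> f {w})"
  proof (cases "m = max_density s")
    case True
    then show ?thesis using inv by (auto simp: state_inv_def)
  next
    case False
    then have "m = Max D" unfolding m_def by linarith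
    then obtain i where i: "i \<in> {1..d}" "m = f {u} / c i u"
      using Max_in[OF D] by (auto simp: D_def)
    \<comment> \<open>Costs are at least 1, so a density never exceeds the value of its
      element.\<close>
    have "f {u} / c i u \<le> f {u} / 1"
      using cost_ge[OF i(1) X(2)] nonneg[of "{u}"] X by (intro divide_left_mono) auto
    then show ?thesis using i by simp
  qed
  have buckets: "bucket_inv (insert u X) v (bucket_of s' v)"
    if v: "v = (1 + \<epsilon>) powi k" "m / (1 + \<epsilon>) \<le> v" for v and k :: int
  proof (cases "v \<in> guesses \<epsilon> d b m")
    case True
    then have "bucket_of s' v = ?step v"
      using fin_guesses by (simp add: bucket_of_def s' map_of_map_restrict)
    \<comment> \<open>The lower end of the range only rises, so the old invariant covers
      \<open>v\<close> even if it enters the range just now.\<close>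
    moreover have "max_density s / (1 + \<epsilon>) \<le> v"
      using v(2) divide_right_mono[OF m(1), of "1 + \<epsilon>"] eps by linarith
    then have "bucket_inv X v (bucket_of s v)"
      using inv v(1) by (simp add: state_inv_def)
    moreover have "v > 0" using v(1) eps by simp
    ultimately show ?thesis
      using bucket_inv_step X by simp
  next
    case False
    then have large: "2 * (real d + 1) * b * m < v"
      using v by (auto simp: guesses_def)
    have empty: "bucket_of s' v = empty_bucket"
      using False fin_guesses by (simp add: bucket_of_def s' map_of_map_restrict)
    \<comment> \<open>The upper end of the range is chosen for this: \<open>v\<close> equals
      \<open>4 * (real d + 1) * target v\<close>, so exceeding
      \<open>2 * (real d + 1) * b * m\<close> means \<open>b * m < 2 * target v\<close>.\<close>
    have "m \<le> threshold v"
    proof -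
      have "(real d + 1) * (m * b) \<le> (real d + 1) * (2 * target v)"
        using large guess_eq_target[of v] by (simp add: algebra_simps)
      then have "m * b \<le> 2 * target v"
        by (rule mult_left_le_imp_le) simp
      then show ?thesis
        using b_pos by (simp add: threshold_def pos_le_divide_eq)
    qed
    have "f {w} \<le> threshold v * c i w" if "w \<in> insert u X" "i \<in> {1..d}" for w i
    proof -
      have "0 \<le> c i w"
        using cost_ge[OF that(2), of w] that(1) X by force
      then have "m * c i w \<le> threshold v * c i w"
        using \<open>m \<le> threshold v\<close> by (intro mult_right_mono)
      then show ?thesis
        using bound[OF that] by linarith
    qed
    then have "bucket_inv (insert u X) v empty_bucket"
      using X by (intro bucket_inv_empty) auto
    then show ?thesis using empty by simp
  qed
  have "map fst (buckets s') = sorted_list_of_set (guesses \<epsilon> d b m)"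
    by (simp add: s' o_def)
  then show ?thesis
    unfolding s'_def[symmetric] state_inv_def
    using m bound witness buckets by (simp add: s')
qed

lemma state_inv_after_arrivals:
  assumes "distinct xs" "set xs \<subseteq> N"
  shows "state_inv (set xs) (after_arrivals (B3 \<epsilon> d b c unc) f xs (initial (B3 \<epsilon> d b c unc)))"
  using assms
proof (induction xs rule: rev_induct)
  case Nil
  then show ?case using state_inv_initial by (simp add: after_arrivals_def B3_def)
next
  case (snoc u xs)
  then show ?case
    using state_inv_arrive[of "set xs" _ u] by (simp add: after_arrivals_def B3_def)
qed

section \<open>Space and queries\<close>

lemma bucket_inv_in_buckets:
  assumes inv: "state_inv X s" and vB: "(v, B) \<in> set (buckets s)"
  shows "v > 0" "bucket_inv X v B"
proof -
  have "v \<in> set (map fst (buckets s))"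
    using vB by force
  moreover have fin_guesses: "finite (guesses \<epsilon> d b (max_density s))"
    using finite_guesses[OF eps b_pos] inv by (simp add: state_inv_def)
  moreover have "map fst (buckets s) = sorted_list_of_set (guesses \<epsilon> d b (max_density s))"
    using inv by (simp add: state_inv_def)
  ultimately have "v \<in> guesses \<epsilon> d b (max_density s)"
    by (simp only: set_sorted_list_of_set)
  then obtain k :: int where k: "v = (1 + \<epsilon>) powi k" "max_density s / (1 + \<epsilon>) \<le> v"
    by (auto simp: guesses_def)
  show "v > 0" using k eps by simp
  have "distinct (map fst (buckets s))"
    using inv by (simp add: state_inv_def)
  then have "bucket_of s v = B"
    using vB by (simp add: bucket_of_def)
  then show "bucket_inv X v B"
    using inv k by (auto simp: state_inv_def)
qed

lemma length_buckets:
  assumes "state_inv X s"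
  shows "length (buckets s) = card (guesses \<epsilon> d b (max_density s))"
proof -
  have "length (buckets s) = length (map fst (buckets s))" by simp
  also have "\<dots> = card (guesses \<epsilon> d b (max_density s))"
    using assms by (simp add: state_inv_def)
  finally show ?thesis .
qed

lemma stored_le:
  assumes "\<And>v B. (v, B) \<in> set (buckets s) \<Longrightarrow>
    real (card (S1 B) + card (S2 B) + card (S3 B) + card (single B)) \<le> K"
  shows "real (stored s) \<le> real (length (buckets s)) * K"
proof -
  have "real (\<Sum>(v, B)\<leftarrow>Bs. card (S1 B) + card (S2 B) + card (S3 B) + card (single B))
      \<le> real (length Bs) * K" if "set Bs \<subseteq> set (buckets s)" for Bs
    using that
  proof (induction Bs)
    case Nil
    then show ?case by simp
  next
    case (Cons p Bs)
    then show ?case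
      using assms[of "fst p" "snd p"] by (auto simp: algebra_simps split: prod.splits)
  qed
  then show ?thesis by (simp add: stored_def)
qed

lemma bucket_inv_cards:
  assumes "bucket_inv X v B" "X \<subseteq> N" "b \<ge> 1"
  shows "real (card (S1 B)) \<le> b" "real (card (S2 B)) \<le> b" "S3 B = {}" "real (card (single B)) \<le> b"
proof -
  show "real (card (S1 B)) \<le> b" "real (card (S2 B)) \<le> b" "S3 B = {}"
    using assms feasible_card_le by (auto simp: bucket_inv_def grown_def)
  have "single B = {} \<or> (\<exists>u. single B = {u})"
    using assms by (auto simp: bucket_inv_def)
  then show "real (card (single B)) \<le> b"
    using assms(3) by auto
qed

text \<open>The factor \<open>4 * b\<close> leaves room for \<open>S3\<close>, so the same bound can
  serve after the pass.\<close>

lemma stored_state_le: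
  assumes "state_inv X s" "X \<subseteq> N" "b \<ge> 1"
  shows "real (stored s) \<le> real (card (guesses \<epsilon> d b (max_density s))) * (4 * b)"
  unfolding length_buckets[OF assms(1), symmetric]
proof (rule stored_le)
  fix v B assume "(v, B) \<in> set (buckets s)"
  then have "bucket_inv X v B"
    using bucket_inv_in_buckets assms(1) by blast
  from bucket_inv_cards[OF this assms(2,3)] assms(3)
  show "real (card (S1 B) + card (S2 B) + card (S3 B) + card (single B)) \<le> 4 * b"
    by simp
qed

text \<open>At most two marginals are computed, at two oracle calls each; the singleton value is
  handed over and shared by all guesses.\<close>

lemma queries_b3_bucket_step: "queries f (b3_bucket_step d b c u x v B) \<le> 4"
  by (simp add: b3_bucket_step_def Let_def)

lemma queries_b3_arrive:
  "queries f (b3_arrive \<epsilon> d b c u s) \<le>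
    1 + 4 * card (guesses \<epsilon> d b (max (max_density s) (Max ((\<lambda>i. f {u} / c i u) ` {1..d}))))"
proof -
  have "(\<Sum>v\<leftarrow>vs. queries f (b3_bucket_step d b c u (f {u}) v (bucket_of s v))) \<le> 4 * length vs" for vs
  proof (induction vs)
    case Nil
    then show ?case by simp
  next
    case (Cons v vs)
    then show ?case
      using queries_b3_bucket_step[of u "f {u}" v "bucket_of s v"] by simp
  qed
  from this[of "sorted_list_of_set (guesses \<epsilon> d b (max (max_density s) (Max ((\<lambda>i. f {u} / c i u) ` {1..d}))))"]
  show ?thesis by (simp add: b3_arrive_def Let_def)
qed

section \<open>Approximation guarantee\<close>

text \<open>The dimension in which an element is low varies with the element, so its cost there is
  replaced by the sum over all dimensions. Exchanging the sums gives \<open>d\<close> copies of the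
  capacity, and \<open>threshold v * b\<close> is \<open>2 * target v\<close>.\<close>

lemma union_le_of_low:
  assumes "v > 0" "S \<subseteq> N" "A \<subseteq> N" "A \<inter> S = {}" "feasible d b c A" "\<And>u. u \<in> A \<Longrightarrow> low v S u"
  shows "f (S \<union> A) \<le> f S + 2 * target v * real d"
proof -
  have finA: "finite A" using assms(3) fin by (rule finite_subset)
  have "f (S \<union> {u}) - f S \<le> threshold v * (\<Sum>i\<in>{1..d}. c i u)" if u: "u \<in> A" for u
  proof -
    obtain i where i: "i \<in> {1..d}" "f (S \<union> {u}) - f S \<le> threshold v * c i u"
      using assms(6)[OF u] by (auto simp: low_def)
    have nn: "0 \<le> c j u" if "j \<in> {1..d}" for j
      using cost_ge[OF that, of u] u assms(3) by force
    then have "c i u \<le> (\<Sum>i\<in>{1..d}. c i u)"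
      using i(1) by (intro member_le_sum) auto
    then show ?thesis
      using i(2) mult_left_mono[OF _ less_imp_le[OF threshold_pos[OF assms(1)]]] by force
  qed
  then have "(\<Sum>u\<in>A. f (S \<union> {u}) - f S) \<le> (\<Sum>u\<in>A. threshold v * (\<Sum>i\<in>{1..d}. c i u))"
    by (rule sum_mono)
  also have "\<dots> = threshold v * (\<Sum>i\<in>{1..d}. \<Sum>u\<in>A. c i u)"
    by (subst sum.swap) (simp add: sum_distrib_left)
  also have "\<dots> \<le> threshold v * (\<Sum>i\<in>{1..d}. b)"
    using threshold_pos[OF assms(1)] assms(5)
    by (intro mult_left_mono sum_mono) (auto simp: feasible_def)
  also have "\<dots> = 2 * target v * real d"
    using b_pos by (simp add: threshold_def)
  finally show ?thesis
    using union_le_sum_marginals[OF submod assms(2) finA assms(3,4)] by linarith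
qed

text \<open>Here \<open>t\<close> stands for the value that the unconstrained subroutine finds
  inside \<open>S1 B\<close>. If every alternative failed, \<open>progress\<close> would make the
  remaining elements of \<open>Z\<close> low, and the bounds on its parts would contradict
  \<open>v \<le> f Z\<close>.\<close>

lemma bucket_value:
  assumes v: "v > 0" and inv: "bucket_inv N v B" and Z: "Z \<subseteq> N" "feasible d b c Z" "v \<le> f Z"
    and half: "f (Z \<inter> S1 B) \<le> 2 * t"
  shows "target v \<le> f (single B) \<and> single B \<noteq> {} \<or> target v \<le> f (S1 B) \<or> target v \<le> f (S2 B) \<or>
    target v \<le> t"
proof (rule ccontr)
  assume contra: "\<not> ?thesis"
  note parts = inv[unfolded bucket_inv_def]
  let ?P = "S1 B" and ?Q = "S2 B"
  have sub: "?P \<subseteq> N" "?Q \<subseteq> N" using parts by auto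
  have low1: "\<forall>u\<in>N - ?P. low v ?P u" and low2: "\<forall>u\<in>N - ?P - ?Q. low v ?Q u"
    using contra parts by (auto simp: progress_def)
  have feas: "feasible d b c (Z - ?P)" "feasible d b c (Z - ?P - ?Q)"
    using Z by (auto intro: feasible_subset)
  have "f (?P \<union> (Z - ?P)) \<le> f ?P + 2 * target v * real d"
    by (rule union_le_of_low[OF v sub(1)]) (use Z feas low1 in auto)
  moreover have "f (?Q \<union> (Z - ?P - ?Q)) \<le> f ?Q + 2 * target v * real d"
    by (rule union_le_of_low[OF v sub(2)]) (use Z feas low2 in auto)
  moreover have "f (Z - ?P) \<le> f (?P \<union> (Z - ?P)) + f (?Q \<union> (Z - ?P - ?Q))"
  proof -
    \<comment> \<open>This uses that \<open>S1 B\<close> and \<open>S2 B\<close> are disjoint; the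
      value of the union is then dropped by nonnegativity.\<close>
    have "(?P \<union> (Z - ?P)) \<inter> (?Q \<union> (Z - ?P - ?Q)) = Z - ?P"
      using parts by auto
    then show ?thesis
      using submodular_onD[OF submod, of "?P \<union> (Z - ?P)" "?Q \<union> (Z - ?P - ?Q)"]
        nonneg[of "(?P \<union> (Z - ?P)) \<union> (?Q \<union> (Z - ?P - ?Q))"] sub Z by force
  qed
  moreover have "f Z \<le> f (Z - ?P) + f (Z \<inter> ?P)"
  proof -
    have "(Z - ?P) \<union> (Z \<inter> ?P) = Z" "(Z - ?P) \<inter> (Z \<inter> ?P) = {}" by auto
    then show ?thesis
      using submodular_onD[OF submod, of "Z - ?P" "Z \<inter> ?P"] nonneg[of "{}"] Z by force
  qed
  ultimately have "v \<le> f ?P + f ?Q + 2 * t + 4 * target v * real d"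
    using Z(3) half by linarith
  \<comment> \<open>After cancelling the terms with \<open>d\<close>, the sum
    \<open>f ?P + f ?Q + 2 * t\<close> is at least \<open>4 * target v\<close>, so one of the three
    values reaches \<open>target v\<close>.\<close>
  moreover have "v = 4 * target v * real d + 4 * target v"
    using guess_eq_target[of v] by (simp add: algebra_simps)
  ultimately show False
    using contra by auto
qed

section \<open>The optimum and its position in the range of guesses\<close>

lemma OPT_attained:
  obtains Z where "Z \<subseteq> N" "feasible d b c Z" "OPT N f d b c = f Z"
proof -
  have "finite {S. S \<subseteq> N \<and> feasible d b c S}"
    using fin by auto
  moreover have "{} \<in> {S. S \<subseteq> N \<and> feasible d b c S}"
    using feasible_empty by simp
  ultimately have "OPT N f d b c \<in> f ` {S. S \<subseteq> N \<and> feasible d b c S}"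
    unfolding OPT_def by (intro Max_in) auto
  then show ?thesis using that by blast
qed

lemma OPT_ge: "S \<subseteq> N \<Longrightarrow> feasible d b c S \<Longrightarrow> f S \<le> OPT N f d b c"
  unfolding OPT_def using fin by (intro Max_ge) auto

text \<open>Subadditivity and the density bound in the first dimension. This puts the optimum below
  the upper end of the range.\<close>

lemma feasible_value_le:
  assumes inv: "state_inv N s" and Z: "Z \<subseteq> N" "Z \<noteq> {}" "feasible d b c Z"
  shows "f Z \<le> max_density s * b"
proof -
  have "f Z \<le> (\<Sum>u\<in>Z. f {u})"
    using le_sum_singletons[OF submod finite_subset[OF Z(1) fin] Z(1,2)] .
  also have "\<dots> \<le> (\<Sum>u\<in>Z. max_density s * c 1 u)"
  proof (rule sum_mono)
    fix u assume "u \<in> Z"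
    moreover have "1 \<in> {1..d}" using d by simp
    ultimately show "f {u} \<le> max_density s * c 1 u"
      using inv Z(1) unfolding state_inv_def by blast
  qed
  also have "\<dots> = max_density s * (\<Sum>u\<in>Z. c 1 u)"
    by (simp add: sum_distrib_left)
  also have "\<dots> \<le> max_density s * b"
    using inv Z d by (intro mult_left_mono) (auto simp: state_inv_def feasible_def)
  finally show ?thesis .
qed

lemma ratio_mult_OPT_le:
  assumes "0 \<le> x"
  shows "(1 / (4 * (real d + 1)) - \<epsilon>) * x \<le> x"
proof -
  have "1 / (4 * (real d + 1)) \<le> 1"
    by (simp add: divide_le_eq)
  then have "(1 / (4 * (real d + 1)) - \<epsilon>) * x \<le> 1 * x"
    using assms eps by (intro mult_right_mono) linarith+
  then show ?thesis by simp
qed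

section \<open>The output after the pass\<close>

lemma buckets_b3_pass_end:
  "buckets (result f (b3_pass_end unc s)) =
    map (\<lambda>(v, B). (v, B\<lparr>S3 := result f (unc (S1 B))\<rparr>)) (buckets s)"
  by (auto simp: b3_pass_end_def)

text \<open>The sets compared at the end, expressed through the state before \<open>S3\<close> is
  filled, since that is the state for which the invariant holds.\<close>

definition candidates :: "('a set \<Rightarrow> ('a, 'a set) prog) \<Rightarrow> 'a b3_state \<Rightarrow> 'a set list" where
  "candidates unc s =
     concat (map (\<lambda>(v, B). [S1 B, S2 B, result f (unc (S1 B)), single B]) (buckets s))"

lemma b3_output_pass_end:
  "b3_output (result f (b3_pass_end unc s)) = argmax_prog (candidates unc s)"
  unfolding b3_output_def buckets_b3_pass_end candidates_def
  by (rule arg_cong[where f = argmax_prog], rule arg_cong[where f = concat]) auto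

lemma candidates_feasible:
  assumes inv: "state_inv N s" and unc: "unconstrained_half_approx N f unc"
    and S: "S \<in> set (candidates unc s)"
  shows "S \<subseteq> N \<and> feasible d b c S"
proof -
  obtain v B where vB: "(v, B) \<in> set (buckets s)"
    and S: "S = S1 B \<or> S = S2 B \<or> S = result f (unc (S1 B)) \<or> S = single B"
    using S by (auto simp: candidates_def)
  note parts = bucket_inv_in_buckets(2)[OF inv vB, unfolded bucket_inv_def]
  have 1: "S1 B \<subseteq> N" "feasible d b c (S1 B)"
    using parts by (auto simp: grown_def)
  moreover have "S2 B \<subseteq> N" "feasible d b c (S2 B)"
    using parts by (auto simp: grown_def)
  moreover have "result f (unc (S1 B)) \<subseteq> S1 B"
    using unc 1 by (simp add: unconstrained_half_approx_def)
  then have "result f (unc (S1 B)) \<subseteq> N" "feasible d b c (result f (unc (S1 B)))"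
    using 1 feasible_subset by auto
  moreover have "single B \<subseteq> N" "feasible d b c (single B)"
    using parts feasible_empty feasible_singleton by auto
  ultimately show ?thesis using S by blast
qed

lemma output_feasible:
  assumes "state_inv N s" "unconstrained_half_approx N f unc"
  shows "result f (argmax_prog (candidates unc s)) \<subseteq> N \<and>
    feasible d b c (result f (argmax_prog (candidates unc s)))"
proof (cases "candidates unc s = []")
  case True
  then show ?thesis using feasible_empty by simp
next
  case False
  then show ?thesis
    using argmax_prog_in candidates_feasible[OF assms] by blast
qed

text \<open>Needed when the empty set is optimal. Without buckets the output is the empty set
  itself; otherwise any \<open>S1\<close> has value at least \<open>f {}\<close>.\<close>

lemma output_ge_empty:
  assumes "state_inv N s"
  shows "f {} \<le> f (result f (argmax_prog (candidates unc s)))"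
proof (cases "buckets s")
  case Nil
  then show ?thesis by (simp add: candidates_def)
next
  case (Cons p Bs)
  obtain v B where vB: "(v, B) \<in> set (buckets s)"
    using Cons by (cases p) auto
  have "f {} \<le> f (S1 B)"
    using grown_ge_empty bucket_inv_in_buckets[OF assms vB] by (auto simp: bucket_inv_def)
  also have "\<dots> \<le> f (result f (argmax_prog (candidates unc s)))"
    using vB by (intro argmax_prog_ge) (force simp: candidates_def)
  finally show ?thesis .
qed

lemma output_value:
  assumes inv: "state_inv N s" and unc: "unconstrained_half_approx N f unc"
  shows "(1 / (4 * (real d + 1)) - \<epsilon>) * OPT N f d b c \<le> f (result f (argmax_prog (candidates unc s)))"
proof -
  let ?S = "result f (argmax_prog (candidates unc s))"
  let ?m = "max_density s"
  obtain Z where Z: "Z \<subseteq> N" "feasible d b c Z" "OPT N f d b c = f Z"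
    by (rule OPT_attained)
  have nonneg_Z: "0 \<le> f Z" and nonneg_S: "0 \<le> f ?S"
    using nonneg Z output_feasible[OF inv unc] by auto
  have m: "0 \<le> ?m" using inv by (simp add: state_inv_def)
  \<comment> \<open>The empty optimum is separate because \<open>feasible_value_le\<close> excludes
    it. In the second case that lemma forces the optimal value to be 0.\<close>
  consider "Z = {}" | "Z \<noteq> {}" "?m = 0" | "Z \<noteq> {}" "?m > 0"
    using m by fastforce
  then show ?thesis
  proof cases
    case 1
    then show ?thesis
      using ratio_mult_OPT_le[OF nonneg_Z] output_ge_empty[OF inv, of unc] Z(3) by simp
  next
    case 2
    then show ?thesis
      using feasible_value_le[OF inv Z(1) _ Z(2)] nonneg_Z nonneg_S Z(3) by simp
  next
    case 3
    have upper: "f Z \<le> ?m * b"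
      using feasible_value_le[OF inv Z(1) 3(1) Z(2)] .
    have lower: "?m \<le> f Z"
    proof -
      obtain u where u: "u \<in> N" "?m \<le> f {u}"
        using inv 3 by (auto simp: state_inv_def)
      then show ?thesis
        using OPT_ge[of "{u}"] feasible_singleton[of u] Z(3) by simp
    qed
    then have "f Z > 0" using 3 by simp
    then obtain k :: int where k: "(1 + \<epsilon>) powi k \<le> f Z" "f Z / (1 + \<epsilon>) < (1 + \<epsilon>) powi k"
      using ex_guess_near[OF eps] by blast
    define v where "v = (1 + \<epsilon>) powi k"
    have v: "v > 0" using eps by (simp add: v_def)
    have "?m / (1 + \<epsilon>) \<le> v"
      using divide_right_mono[OF lower, of "1 + \<epsilon>"] k(2) eps by (simp add: v_def)
    \<comment> \<open>For the optimum alone \<open>b * ?m\<close> would suffice as upper end; the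
      further factor is at least 1.\<close>
    moreover have "v \<le> 2 * (real d + 1) * b * ?m"
    proof -
      have "1 * (?m * b) \<le> (2 * (real d + 1)) * (?m * b)"
        using m b_pos by (intro mult_right_mono) auto
      then show ?thesis using k(1) upper by (simp add: v_def ac_simps)
    qed
    ultimately have guess: "v \<in> guesses \<epsilon> d b ?m"
      by (auto simp: guesses_def v_def)
    have "map fst (buckets s) = sorted_list_of_set (guesses \<epsilon> d b ?m)"
      using inv by (simp add: state_inv_def)
    then have "v \<in> set (map fst (buckets s))"
      using guess finite_guesses[OF eps b_pos m] by (simp only: set_sorted_list_of_set)
    then obtain B where vB: "(v, B) \<in> set (buckets s)"
      by auto
    have cand: "set [S1 B, S2 B, result f (unc (S1 B)), single B] \<subseteq> set (candidates unc s)"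
      by (auto simp: candidates_def intro!: bexI[OF _ vB])
    have B: "bucket_inv N v B"
      by (rule bucket_inv_in_buckets(2)[OF inv vB])
    then have "S1 B \<subseteq> N" by (simp add: bucket_inv_def)
    have "f (Z \<inter> S1 B) \<le> Max (f ` Pow (S1 B))"
      using finite_subset[OF \<open>S1 B \<subseteq> N\<close> fin] by (intro Max_ge) auto
    moreover have "1 / 2 * Max (f ` Pow (S1 B)) \<le> f (result f (unc (S1 B)))"
      using unc \<open>S1 B \<subseteq> N\<close> unfolding unconstrained_half_approx_def by blast
    ultimately have half: "f (Z \<inter> S1 B) \<le> 2 * f (result f (unc (S1 B)))"
      by linarith
    have "target v \<le> f (single B) \<or> target v \<le> f (S1 B) \<or> target v \<le> f (S2 B) \<or>
        target v \<le> f (result f (unc (S1 B)))"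
      using bucket_value[OF v B Z(1,2) _ half] k(1) unfolding v_def by blast
    then obtain A where A: "A \<in> set (candidates unc s)" "target v \<le> f A"
      using cand by auto
    have "target v \<le> f ?S"
      using A(2) argmax_prog_ge[OF A(1), of f] by linarith
    moreover have "(1 / (4 * (real d + 1)) - \<epsilon>) * f Z \<le> target v"
    proof -
      \<comment> \<open>Rounding the optimum down to a power costs a factor
        \<open>1 / (1 + \<epsilon>)\<close>, which is at least
        \<open>1 - \<epsilon>\<close>.\<close>
      have "(1 - \<epsilon>) * (1 + \<epsilon>) \<le> 1"
        using eps by (simp add: algebra_simps)
      then have "1 - \<epsilon> \<le> 1 / (1 + \<epsilon>)"
        using eps by (simp add: pos_le_divide_eq)
      then have "(1 - \<epsilon>) * f Z \<le> 1 / (1 + \<epsilon>) * f Z"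
        using nonneg_Z by (rule mult_right_mono)
      then have "(1 - \<epsilon>) * f Z \<le> v"
        using k(2) by (simp add: v_def)
      then have "(1 - \<epsilon>) * f Z / (4 * (real d + 1)) \<le> target v"
        unfolding target_def by (rule divide_right_mono) simp
      moreover have "\<epsilon> / (4 * (real d + 1)) \<le> \<epsilon>"
        using eps by (simp add: divide_le_eq)
      then have "(1 / (4 * (real d + 1)) - \<epsilon>) * f Z \<le> ((1 - \<epsilon>) / (4 * (real d + 1))) * f Z"
        using nonneg_Z by (intro mult_right_mono) (auto simp: diff_divide_distrib)
      ultimately show ?thesis by simp
    qed
    ultimately show ?thesis using Z(3) by simp
  qed
qed

text \<open>The subroutine returns a subset of \<open>S1\<close>, so \<open>S3\<close> also has at
  most \<open>b\<close> elements.\<close>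

lemma stored_pass_end_le:
  assumes inv: "state_inv N s" and unc: "unconstrained_half_approx N f unc" and "b \<ge> 1"
  shows "real (stored (result f (b3_pass_end unc s))) \<le>
    real (card (guesses \<epsilon> d b (max_density s))) * (4 * b)"
proof -
  let ?t = "result f (b3_pass_end unc s)"
  have len: "length (buckets ?t) = card (guesses \<epsilon> d b (max_density s))"
    using length_buckets[OF inv] by (simp add: buckets_b3_pass_end)
  show ?thesis
    unfolding len[symmetric]
  proof (rule stored_le)
    fix v B assume "(v, B) \<in> set (buckets ?t)"
    then obtain B' where B': "(v, B') \<in> set (buckets s)" "B = B'\<lparr>S3 := result f (unc (S1 B'))\<rparr>"
      by (auto simp: buckets_b3_pass_end)
    have "bucket_inv N v B'"
      by (rule bucket_inv_in_buckets(2)[OF inv B'(1)])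
    note cards = bucket_inv_cards[OF this order_refl assms(3)]
    have "S1 B' \<subseteq> N"
      using \<open>bucket_inv N v B'\<close> by (simp add: bucket_inv_def)
    then have "card (result f (unc (S1 B'))) \<le> card (S1 B')"
      using unc fin by (intro card_mono) (auto simp: unconstrained_half_approx_def intro: finite_subset)
    then show "real (card (S1 B) + card (S2 B) + card (S3 B) + card (single B)) \<le> 4 * b"
      using cards B'(2) by simp
  qed
qed

end

text \<open>\<open>C\<close> is fixed before the stream, the function, the capacity, the costs and
  \<open>\<epsilon>\<close>. As \<open>ln b / \<epsilon>\<close> can become arbitrarily small while
  each arrival still costs a query, the complexity bounds are stated for \<open>b \<ge> b0\<close>
  and \<open>\<epsilon> \<le> \<epsilon>0\<close>. Oracle calls of the subroutine fall at the end of
  the pass and are not charged to an arrival.\<close>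

theorem theorem6:
  fixes d :: nat and b0 \<epsilon>0 :: real
  assumes "d \<ge> 1" and "b0 > 1" and "\<epsilon>0 > 0"
  shows "\<exists>C>0. \<forall>(us :: 'a list) (f :: 'a set \<Rightarrow> real) (b :: real) (c :: nat \<Rightarrow> 'a \<Rightarrow> real)
           (\<epsilon> :: real) (unc :: 'a set \<Rightarrow> ('a, 'a set) prog).
     distinct us \<and> nonneg_submodular_on (set us) f \<and> standardized_knapsack (set us) d b c \<and>
     \<epsilon> > 0 \<and> unconstrained_half_approx (set us) f unc \<longrightarrow>
     (let A = B3 \<epsilon> d b c unc;
          state = (\<lambda>j. after_arrivals A f (take j us) (initial A)) in
      \<exists>t. run A f us (initial A) 1 t \<and>
        (let S = result f (final_output A t) in
           S \<subseteq> set us \<and> feasible d b c S \<and>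
           f S \<ge> (1 / (4 * (real d + 1)) - \<epsilon>) * OPT (set us) f d b c) \<and>
        (b \<ge> b0 \<and> \<epsilon> \<le> \<epsilon>0 \<longrightarrow>
           (\<forall>j\<le>length us. real (stored (state j)) \<le> C * (b * ln b / \<epsilon>)) \<and>
           real (stored t) \<le> C * (b * ln b / \<epsilon>) \<and>
           (\<forall>j<length us. real (queries f (arrive A (us ! j) (state j))) \<le> C * (ln b / \<epsilon>))))"
proof -
  obtain K where K: "K > 0" and K_bound: "\<And>b \<epsilon> m. b \<ge> b0 \<Longrightarrow> 0 < \<epsilon> \<Longrightarrow> \<epsilon> \<le> \<epsilon>0 \<Longrightarrow> m \<ge> 0 \<Longrightarrow>
      1 \<le> K * (ln b / \<epsilon>) \<and> real (card (guesses \<epsilon> d b m)) \<le> K * (ln b / \<epsilon>)"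
    using card_guesses_bound[OF assms(2,3), of d] by blast
  show ?thesis
  \<comment> \<open>An arrival makes at most one query plus four per guess; both the 1 and the
    number of guesses are at most \<open>K * (ln b / \<epsilon>)\<close>, hence the 5.\<close>
  proof (intro exI[of _ "5 * K"] conjI allI impI, use K in simp)
    fix us :: "'a list" and f :: "'a set \<Rightarrow> real" and b :: real and c :: "nat \<Rightarrow> 'a \<Rightarrow> real"
      and \<epsilon> :: real and unc :: "'a set \<Rightarrow> ('a, 'a set) prog"
    assume H: "distinct us \<and> nonneg_submodular_on (set us) f \<and> standardized_knapsack (set us) d b c \<and>
      \<epsilon> > 0 \<and> unconstrained_half_approx (set us) f unc"
    then interpret b3_setting "set us" f d b c \<epsilon>
      using assms(1) by unfold_locales auto
    have unc: "unconstrained_half_approx (set us) f unc" using H by simp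
    define A where "A = B3 \<epsilon> d b c unc"
    define state where "state = (\<lambda>j. after_arrivals A f (take j us) (initial A))"
    define t where "t = result f (b3_pass_end unc (state (length us)))"
    have inv: "state_inv (set (take j us)) (state j)" for j
      unfolding state_def A_def
      by (rule state_inv_after_arrivals) (use H in \<open>auto dest: in_set_takeD\<close>)
    have inv_end: "state_inv (set us) (state (length us))"
      using inv[of "length us"] by simp
    have t: "after_pass A f us (initial A) = t"
      by (simp add: after_pass_def t_def state_def A_def B3_def)
    have run: "run A f us (initial A) 1 t"
      using run.stop[of A f us "initial A"] unfolding t by (simp add: A_def B3_def)
    have final: "result f (final_output A t) = result f (argmax_prog (candidates unc (state (length us))))"
      unfolding t_def b3_output_pass_end[symmetric] by (simp add: A_def B3_def)
    have space: "real (stored (state j)) \<le> 5 * K * (b * ln b / \<epsilon>)"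
      and space_end: "real (stored t) \<le> 5 * K * (b * ln b / \<epsilon>)"
      and query: "real (queries f (arrive A (us ! j) (state j))) \<le> 5 * K * (ln b / \<epsilon>)"
      if b: "b \<ge> b0" "\<epsilon> \<le> \<epsilon>0" for j
    proof -
      have b1: "b \<ge> 1" using b assms(2) by simp
      note bound = K_bound[OF b(1) eps b(2)]
      have "0 \<le> ln b / \<epsilon>" using b1 eps by simp
      have mult_b: "x * (4 * b) \<le> 5 * K * (b * ln b / \<epsilon>)" if "x \<le> K * (ln b / \<epsilon>)" for x
      proof -
        have "0 \<le> K * (ln b / \<epsilon>)"
          using K \<open>0 \<le> ln b / \<epsilon>\<close> by (intro mult_nonneg_nonneg) auto
        then have "x * (4 * b) \<le> K * (ln b / \<epsilon>) * (5 * b)"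
          using that b1 by (intro mult_mono) auto
        then show ?thesis by (simp add: ac_simps)
      qed
      have pos: "0 \<le> max_density (state j)" for j
        using inv[of j] by (simp add: state_inv_def)
      show "real (stored (state j)) \<le> 5 * K * (b * ln b / \<epsilon>)"
        using stored_state_le[OF inv[of j] _ b1] mult_b bound[OF pos[of j]] set_take_subset[of j us]
        by (meson order_trans)
      show "real (stored t) \<le> 5 * K * (b * ln b / \<epsilon>)"
        unfolding t_def
        using stored_pass_end_le[OF inv_end unc b1] mult_b bound[OF pos[of "length us"]]
        by (meson order_trans)
      let ?m = "max (max_density (state j)) (Max ((\<lambda>i. f {us ! j} / c i (us ! j)) ` {1..d}))"
      have "arrive A (us ! j) (state j) = b3_arrive \<epsilon> d b c (us ! j) (state j)"
        by (simp add: A_def B3_def)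
      then have "real (queries f (arrive A (us ! j) (state j))) \<le> 1 + 4 * real (card (guesses \<epsilon> d b ?m))"
        using of_nat_mono[OF queries_b3_arrive[of "us ! j" "state j"], where 'a = real] by simp
      moreover have "0 \<le> ?m" using pos[of j] by simp
      note bound[OF this]
      ultimately show "real (queries f (arrive A (us ! j) (state j))) \<le> 5 * K * (ln b / \<epsilon>)"
        by linarith
    qed
    have "run A f us (initial A) 1 t \<and>
        (let S = result f (final_output A t) in
           S \<subseteq> set us \<and> feasible d b c S \<and>
           f S \<ge> (1 / (4 * (real d + 1)) - \<epsilon>) * OPT (set us) f d b c) \<and>
        (b \<ge> b0 \<and> \<epsilon> \<le> \<epsilon>0 \<longrightarrow>
           (\<forall>j\<le>length us. real (stored (state j)) \<le> 5 * K * (b * ln b / \<epsilon>)) \<and>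
           real (stored t) \<le> 5 * K * (b * ln b / \<epsilon>) \<and>
           (\<forall>j<length us. real (queries f (arrive A (us ! j) (state j))) \<le> 5 * K * (ln b / \<epsilon>)))"
      using run output_feasible[OF inv_end unc] output_value[OF inv_end unc] space space_end query
      unfolding final Let_def by blast
    then show "let A = B3 \<epsilon> d b c unc;
          state = (\<lambda>j. after_arrivals A f (take j us) (initial A)) in
      \<exists>t. run A f us (initial A) 1 t \<and>
        (let S = result f (final_output A t) in
           S \<subseteq> set us \<and> feasible d b c S \<and>
           f S \<ge> (1 / (4 * (real d + 1)) - \<epsilon>) * OPT (set us) f d b c) \<and>
        (b \<ge> b0 \<and> \<epsilon> \<le> \<epsilon>0 \<longrightarrow>
           (\<forall>j\<le>length us. real (stored (state j)) \<le> 5 * K * (b * ln b / \<epsilon>)) \<and>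
           real (stored t) \<le> 5 * K * (b * ln b / \<epsilon>) \<and>
           (\<forall>j<length us. real (queries f (arrive A (us ! j) (state j))) \<le> 5 * K * (ln b / \<epsilon>)))"
      unfolding A_def state_def Let_def by blast
  qed
qed

end
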